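(* Let $\lambda>0$. For any interval $I=I(x,r)\subset\mathbb{R}_+$ with $x\ge r>0$, and $2I:=I(x,2r)$, $$\min\big(2,2^{2\lambda}\big)\,m_\lambda(I)\le m_\lambda(2I)\le 2^{2\lambda+1}\,m_\lambda(I).$$
   Context: $\mathbb{R}_+:=(0,\infty)$, $\lambda>0$ is fixed, and $m_\lambda(E):=\int_E y^{2\lambda}\,dy$ for measurable $E\subset\mathbb{R}_+$. For $x,r\in\mathbb{R}_+$, $I(x,r):=(x-r,x+r)\cap\mathbb{R}_+$. (If $x<r$ then $I(x,r)=(0,x+r)=I(\frac{x+r}2,\frac{x+r}2)$, so every such interval can be represented with center $\ge$ radius.) In particular $2I=(x-2r,x+2r)\cap\mathbb{R}_+$. *)

theory Defs
  imports "HOL-Analysis.Analysis"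
begin

definition pos_reals :: "real set"
  where "pos_reals = {0<..}"

definition pos_interval :: "real \<Rightarrow> real \<Rightarrow> real set"
  where "pos_interval x r = {x - r <..< x + r} \<inter> pos_reals"

(* Meant for Lebesgue measurable E contained in the positive reals.  The value is an extended
   nonnegative real, so that sets of infinite measure are not given a junk value. *)
definition m_lambda :: "real \<Rightarrow> real set \<Rightarrow> ennreal"
  where "m_lambda lam E = (\<integral>\<^sup>+ y \<in> E. ennreal (y powr (2 * lam)) \<partial>lebesgue)"

end

(* Mapping both intervals affinely onto (-1,1) reduces the two estimates to pointwise inequalities
   for f(y) = max(y,0)^p, p = 2*lam, with 0 <= |u| < x.  For the upper bound,
   f(x+2u) <= 2^p f(x+u) because x+2u <= 2(x+u).  The lower bound holds only after averaging over
   u and -u: f(x+2u) + f(x-2u) dominates f(x+u) + f(x-u) for p >= 1 (convexity) and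
   2^(p-1) (f(x+u) + f(x-u)) for p <= 1 (both sides are separated by (2x)^p). *)
theory Submission
  imports Defs
begin

text \<open>Each summand splits as \<open>c powr p = c * c powr (p - 1)\<close>, and the second
  factor is at most \<open>(a + b) powr (p - 1)\<close> because \<open>p - 1\<close> is nonnegative;
  adding the two bounds gives the claim.\<close>

lemma powr_add_powr_le_add_powr:
  fixes a b p :: real
  assumes "0 \<le> a" "0 \<le> b" "1 \<le> p"
  shows "a powr p + b powr p \<le> (a + b) powr p"
proof (cases "a + b = 0")
  case False
  have "c powr p \<le> c * (a + b) powr (p - 1)" if "0 \<le> c" "c \<le> a + b" for c
  proof (cases "c = 0")
    case False
    then have "c powr p = c * c powr (p - 1)"
      using that powr_mult_base[of c "p - 1"] by simp
    then show ?thesis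
      using that assms by (simp add: mult_left_mono powr_mono2)
  qed simp
  from this[of a] this[of b] have "a powr p + b powr p \<le> (a + b) * (a + b) powr (p - 1)"
    using assms by (simp add: distrib_right)
  then show ?thesis
    using assms powr_mult_base[of "a + b" "p - 1"] by simp
qed (use assms in \<open>simp add: add_nonneg_eq_0_iff\<close>)

text \<open>Dual to the superadditive case: that lemma is applied to \<open>a powr p\<close> and
  \<open>b powr p\<close> with exponent \<open>1 / p \<ge> 1\<close>, and then the
  \<open>p\<close>-th power is taken.\<close>

lemma add_powr_le_powr_add_powr:
  fixes a b p :: real
  assumes "0 \<le> a" "0 \<le> b" "0 < p" "p \<le> 1"
  shows "(a + b) powr p \<le> a powr p + b powr p"
proof -
  have "a + b \<le> (a powr p + b powr p) powr (1 / p)"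
    using powr_add_powr_le_add_powr[of "a powr p" "b powr p" "1 / p"] assms by (simp add: powr_powr)
  then have "(a + b) powr p \<le> ((a powr p + b powr p) powr (1 / p)) powr p"
    using assms by (intro powr_mono2) auto
  then show ?thesis
    using assms by (simp add: powr_powr)
qed

lemma midpoint_powr_le:
  fixes a b p :: real
  assumes "0 < a" "0 < b" "1 \<le> p"
  shows "((a + b) / 2) powr p \<le> (a powr p + b powr p) / 2"
  using convex_onD[OF powr_convex[OF assms(3)], of "1/2" a b] assms by (simp add: field_simps)

text \<open>Midpoint concavity follows from midpoint convexity by the same duality between
  \<open>p\<close> and \<open>1 / p\<close>.\<close>

lemma powr_add_powr_le_midpoint:
  fixes a b p :: real
  assumes "0 < a" "0 < b" "0 < p" "p \<le> 1"
  shows "(a powr p + b powr p) / 2 \<le> ((a + b) / 2) powr p"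
proof -
  have "((a powr p + b powr p) / 2) powr (1 / p) \<le> (a + b) / 2"
    using midpoint_powr_le[of "a powr p" "b powr p" "1 / p"] assms by (simp add: powr_powr)
  then have "(((a powr p + b powr p) / 2) powr (1 / p)) powr p \<le> ((a + b) / 2) powr p"
    using assms by (intro powr_mono2) auto
  then show ?thesis
    using assms by (simp add: powr_powr)
qed

lemma powr_add_powr_le_spread:
  fixes x u p :: real
  assumes "0 \<le> u" "u < x" "1 \<le> p"
  shows "(x + u) powr p + (x - u) powr p \<le> (x + 2 * u) powr p + max (x - 2 * u) 0 powr p"
proof (cases "2 * u < x")
  case True
  \<comment> \<open>The points \<open>x + u\<close> and \<open>x - u\<close> are the outer quarter
    points of the segment between \<open>x - 2 * u\<close> and \<open>x + 2 * u\<close>. The two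
    weight pairs are mirror images, so adding the convexity bounds gives each endpoint total weight
    1.\<close>
  have "(1 - 3/4) *\<^sub>R (x - 2 * u) + (3/4) *\<^sub>R (x + 2 * u) = x + u"
    "(1 - 1/4) *\<^sub>R (x - 2 * u) + (1/4) *\<^sub>R (x + 2 * u) = x - u"
    by (simp_all add: field_simps)
  then have "(x + u) powr p \<le> (1/4) * (x - 2 * u) powr p + (3/4) * (x + 2 * u) powr p"
    "(x - u) powr p \<le> (3/4) * (x - 2 * u) powr p + (1/4) * (x + 2 * u) powr p"
    using convex_onD[OF powr_convex[OF assms(3)], of "3/4" "x - 2 * u" "x + 2 * u"]
      convex_onD[OF powr_convex[OF assms(3)], of "1/4" "x - 2 * u" "x + 2 * u"] True assms
    by simp_all
  then show ?thesis
    using True by (simp add: max_def)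
next
  case False
  \<comment> \<open>Here the left endpoint is no longer positive, so convexity on the positive axis
    does not apply. Superadditivity replaces it, and \<open>x \<le> 2 * u\<close> lets the term at
    \<open>x + 2 * u\<close> alone dominate.\<close>
  have "(x + u) powr p + (x - u) powr p \<le> (2 * x) powr p"
    using powr_add_powr_le_add_powr[of "x + u" "x - u" p] assms by simp
  also have "\<dots> \<le> (x + 2 * u) powr p"
    using False assms by (intro powr_mono2) auto
  finally show ?thesis
    by (simp add: add_increasing2)
qed

lemma powr_add_powr_le_spread_concave:
  fixes x u p :: real
  assumes "0 \<le> u" "u < x" "0 < p" "p \<le> 1"
  shows "2 powr p * ((x + u) powr p + (x - u) powr p)
           \<le> 2 * ((x + 2 * u) powr p + max (x - 2 * u) 0 powr p)"
proof -
  have "(x + u) powr p + (x - u) powr p \<le> 2 * x powr p"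
    using powr_add_powr_le_midpoint[of "x + u" "x - u" p] assms by simp
  then have "2 powr p * ((x + u) powr p + (x - u) powr p) \<le> 2 powr p * (2 * x powr p)"
    by (rule mult_left_mono) simp
  also have "\<dots> = 2 * (2 * x) powr p"
    by (simp add: powr_mult)
  \<comment> \<open>The untruncated arguments sum to exactly \<open>2 * x\<close>; truncating at 0
    can only increase the sum.\<close>
  also have "(2 * x) powr p \<le> ((x + 2 * u) + max (x - 2 * u) 0) powr p"
    using assms by (intro powr_mono2) auto
  also have "\<dots> \<le> (x + 2 * u) powr p + max (x - 2 * u) 0 powr p"
    using assms by (intro add_powr_le_powr_add_powr) auto
  finally show ?thesis
    by simp
qed

lemma min_mult_powr_le_spread:
  fixes x u p :: real
  assumes "\<bar>u\<bar> < x" "0 < p"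
  shows "min 2 (2 powr p) * (max (x + u) 0 powr p + max (x - u) 0 powr p)
           \<le> 2 * (max (x + 2 * u) 0 powr p + max (x - 2 * u) 0 powr p)"
proof -
  have *: "min 2 (2 powr p) * (max (x + v) 0 powr p + max (x - v) 0 powr p)
           \<le> 2 * (max (x + 2 * v) 0 powr p + max (x - 2 * v) 0 powr p)"
    if v: "0 \<le> v" "v < x" for v
  proof (cases "1 \<le> p")
    case True
    have "(2::real) powr 1 \<le> 2 powr p"
      using True by (intro powr_mono) auto
    then show ?thesis
      using powr_add_powr_le_spread[OF v True] v by (simp add: min_absorb1 max_absorb1)
  next
    case False
    have "2 powr p \<le> (2::real) powr 1"
      using False by (intro powr_mono) auto
    then show ?thesis
      using powr_add_powr_le_spread_concave[of v x p] v False assms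
      by (simp add: min_absorb2 max_absorb1)
  qed
  \<comment> \<open>Both sides are invariant under replacing \<open>u\<close> by \<open>- u\<close>,
    so nonnegative \<open>u\<close> suffices.\<close>
  show ?thesis
    using *[of u] *[of "- u"] assms by (cases "0 \<le> u") (auto simp: add.commute)
qed

text \<open>Substitution \<open>y = x + s * t\<close> with Jacobian \<open>r\<close>. The slope
  \<open>s\<close> may have either sign, so that the integral is available in reflected form too.
  Since \<open>0 powr p = 0\<close>, the truncation \<open>max y 0\<close> takes over the
  intersection with the positive reals.\<close>

lemma m_lambda_pos_interval_affine:
  assumes "0 < r" "\<bar>s\<bar> = r"
  shows "m_lambda lam (pos_interval x r)
           = ennreal r * (\<integral>\<^sup>+t\<in>{-1<..<1}. ennreal (max (x + s * t) 0 powr (2 * lam)) \<partial>lborel)"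
proof -
  have "m_lambda lam (pos_interval x r)
          = (\<integral>\<^sup>+y\<in>{x - r<..<x + r}. ennreal (max y 0 powr (2 * lam)) \<partial>lborel)"
    unfolding m_lambda_def nn_integral_completion
    by (intro nn_integral_cong)
       (auto simp: pos_interval_def pos_reals_def indicator_def max_def)
  also have "\<dots> = ennreal r * (\<integral>\<^sup>+t. ennreal (max (x + s * t) 0 powr (2 * lam))
                    * indicator {x - r<..<x + r} (x + s * t) \<partial>lborel)"
    using assms by (subst nn_integral_real_affine[where c = s and t = x]) auto
  also have "(\<lambda>t. indicator {x - r<..<x + r} (x + s * t) :: ennreal) = indicator {-1<..<1}"
  proof
    fix t
    have "x + s * t \<in> {x - r<..<x + r} \<longleftrightarrow> \<bar>s * t\<bar> < r"
      by auto
    also have "\<dots> \<longleftrightarrow> r * \<bar>t\<bar> < r * 1"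
      using assms by (simp add: abs_mult)
    also have "\<dots> \<longleftrightarrow> t \<in> {-1<..<1}"
      using assms by (subst mult_less_cancel_left_pos) auto
    finally show "(indicator {x - r<..<x + r} (x + s * t) :: ennreal) = indicator {-1<..<1} t"
      by (simp add: indicator_def)
  qed
  finally show ?thesis .
qed

text \<open>Adding the affine formulas for slopes \<open>r\<close> and \<open>- r\<close>
  symmetrizes the integrand; keeping the factor 2 on the left avoids division in
  \<open>ennreal\<close>.\<close>

lemma two_mult_m_lambda_pos_interval:
  assumes "0 < r"
  shows "2 * m_lambda lam (pos_interval x r)
           = ennreal r * (\<integral>\<^sup>+t\<in>{-1<..<1}. ennreal (max (x + r * t) 0 powr (2 * lam)
                + max (x - r * t) 0 powr (2 * lam)) \<partial>lborel)"
proof -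
  have "2 * m_lambda lam (pos_interval x r)
          = m_lambda lam (pos_interval x r) + m_lambda lam (pos_interval x r)"
    by (simp add: mult_2)
  also have "\<dots> = ennreal r * (\<integral>\<^sup>+t\<in>{-1<..<1}. ennreal (max (x + r * t) 0 powr (2 * lam)) \<partial>lborel)
      + ennreal r * (\<integral>\<^sup>+t\<in>{-1<..<1}. ennreal (max (x + (- r) * t) 0 powr (2 * lam)) \<partial>lborel)"
    using m_lambda_pos_interval_affine[of r r lam x] m_lambda_pos_interval_affine[of r "- r" lam x]
      assms by simp
  also have "\<dots> = ennreal r * (\<integral>\<^sup>+t. ennreal (max (x + r * t) 0 powr (2 * lam)) * indicator {-1<..<1} t
      + ennreal (max (x + (- r) * t) 0 powr (2 * lam)) * indicator {-1<..<1} t \<partial>lborel)"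
    by (subst nn_integral_add) (auto simp: distrib_left)
  finally show ?thesis
    by (simp add: distrib_right)
qed

theorem proposition2p1:
  fixes lam x r :: real
  assumes "lam > 0" and "r > 0" and "x \<ge> r"
  shows "ennreal (min 2 (2 powr (2 * lam))) * m_lambda lam (pos_interval x r)
           \<le> m_lambda lam (pos_interval x (2 * r))
       \<and> m_lambda lam (pos_interval x (2 * r))
           \<le> ennreal (2 powr (2 * lam + 1)) * m_lambda lam (pos_interval x r)"
proof
  let ?p = "2 * lam" and ?C = "min 2 (2 powr (2 * lam))"
  let ?f = "\<lambda>y. max y 0 powr ?p"
  \<comment> \<open>The condition \<open>x \<ge> r\<close> supplies the hypothesis of the pointwise
    estimate with \<open>u = r * t\<close>.\<close>
  have small: "\<bar>r * t\<bar> < x" if "t \<in> {-1<..<1}" for t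
  proof -
    have "r * \<bar>t\<bar> < r * 1"
      using that assms by (intro mult_strict_left_mono) auto
    also have "\<dots> \<le> x"
      using assms by simp
    finally show ?thesis
      using assms by (simp add: abs_mult)
  qed
  have "2 * (ennreal ?C * m_lambda lam (pos_interval x r))
      = ennreal ?C * (2 * m_lambda lam (pos_interval x r))"
    by (simp add: mult.left_commute)
  also have "\<dots> = ennreal r * (\<integral>\<^sup>+t\<in>{-1<..<1}. ennreal (?C * (?f (x + r * t) + ?f (x - r * t))) \<partial>lborel)"
    unfolding two_mult_m_lambda_pos_interval[OF assms(2)]
    by (simp add: ennreal_mult mult.assoc mult.left_commute[of "ennreal r"] nn_integral_cmult)
  also have "\<dots> \<le> ennreal r * (\<integral>\<^sup>+t\<in>{-1<..<1}. ennreal (2 * (?f (x + 2 * r * t) + ?f (x - 2 * r * t))) \<partial>lborel)"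
  proof (intro mult_left_mono nn_integral_mono)
    fix t
    show "ennreal (?C * (?f (x + r * t) + ?f (x - r * t))) * indicator {-1<..<1} t
        \<le> ennreal (2 * (?f (x + 2 * r * t) + ?f (x - 2 * r * t))) * indicator {-1<..<1} t"
      using min_mult_powr_le_spread[of "r * t" x ?p] small[of t] assms
      by (auto simp: indicator_def mult.assoc simp del: ennreal_plus intro!: ennreal_leI)
  qed simp
  \<comment> \<open>The 2 inside the integral joins \<open>r\<close> to form the Jacobian
    \<open>2 * r\<close> of the doubled interval.\<close>
  also have "\<dots> = 2 * m_lambda lam (pos_interval x (2 * r))"
    using assms
    by (subst two_mult_m_lambda_pos_interval)
       (simp_all add: ennreal_mult mult.assoc mult.left_commute[of "ennreal r"] nn_integral_cmult
          del: ennreal_plus distrib_left_numeral)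
  \<comment> \<open>The common factor 2 is nonzero and finite, hence cancels in
    \<open>ennreal\<close>.\<close>
  finally show "ennreal ?C * m_lambda lam (pos_interval x r) \<le> m_lambda lam (pos_interval x (2 * r))"
    by (subst (asm) ennreal_mult_le_mult_iff) auto

  have "m_lambda lam (pos_interval x (2 * r))
      = ennreal (2 * r) * (\<integral>\<^sup>+t\<in>{-1<..<1}. ennreal (?f (x + 2 * r * t)) \<partial>lborel)"
    using assms by (intro m_lambda_pos_interval_affine) auto
  also have "\<dots> \<le> ennreal (2 * r) * (\<integral>\<^sup>+t\<in>{-1<..<1}. ennreal (2 powr ?p * ?f (x + r * t)) \<partial>lborel)"
  proof (intro mult_left_mono nn_integral_mono)
    fix t
    have "?f (x + 2 * r * t) \<le> (2 * max (x + r * t) 0) powr ?p"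
      using assms by (intro powr_mono2) (auto simp: max_def mult.assoc)
    then show "ennreal (?f (x + 2 * r * t)) * indicator {-1<..<1} t
        \<le> ennreal (2 powr ?p * ?f (x + r * t)) * indicator {-1<..<1} t"
      by (auto simp: indicator_def powr_mult intro!: ennreal_leI)
  qed simp
  also have "\<dots> = ennreal (2 * r) * (ennreal (2 powr ?p)
      * (\<integral>\<^sup>+t\<in>{-1<..<1}. ennreal (?f (x + r * t)) \<partial>lborel))"
    by (simp add: ennreal_mult mult.assoc nn_integral_cmult)
  \<comment> \<open>The Jacobian ratio of \<open>2 * r\<close> to \<open>r\<close> contributes the
    additional 1 in the exponent.\<close>
  also have "\<dots> = ennreal (2 powr (?p + 1)) * m_lambda lam (pos_interval x r)"
    using assms
    by (subst m_lambda_pos_interval_affine[of r r]) (simp_all add: ennreal_mult powr_add mult_ac)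
  finally show "m_lambda lam (pos_interval x (2 * r))
      \<le> ennreal (2 powr (?p + 1)) * m_lambda lam (pos_interval x r)" .
qed

end
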